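(* Let $f(x)=x+h(x)$ be a map in the New Class; that is, $f:\mathbb{R}^n\to\mathbb{R}^n$ is $C^1$ and $h\in\mathcal{H}_n$. Then \begin{enumerate} \item If $r\in\mathbb{R}$, then $rh\in\mathcal{H}_n$. \item If $T$ is a linear map of $\mathbb{R}^n$ to itself, then $T^a\circ h\circ T\in\mathcal{H}_n$, where $T^a$ is the linear map whose matrix is the classical adjoint of the matrix of $T$. \item If $C$ is a constant vector of length $n$, then $h+C\in\mathcal{H}_n$. \item $J(h)$ is nilpotent (and thus $J(f)$ is unipotent). \item The composition power $h^{\circ n}=h\circ h\circ\cdots\circ h$ ($n$ factors) is constant. \item The map $f$ is invertible, with an explicit inverse. \end{enumerate}
   Context: $J(\cdot)$ denotes the Jacobian matrix; nilpotence and unipotence (all eigenvalues equal to $1$, i.e. identity plus nilpotent) are meant at every point of $\mathbb{R}^n$. Invertible means bijective. An inverse is called explicit if it is represented by a finite formula involving, apart from composition, only algebraic operations and the components of the map. The classical adjoint $\mathrm{adj}(B)$ of a square matrix $B$ is the transposed cofactor matrix, so $\mathrm{adj}(B)B=B\,\mathrm{adj}(B)=\det(B)I$ (it is the matrix $(1)$ if $B$ is $1\times1$). Definition of the sets $\mathcal{H}_{n,i}$ and $\mathcal{H}_n$. Let $n$ be a positive integer and $x=(x_1,\ldots,x_n)$ a fixed linear coordinate system for $\mathbb{R}^n$. Sets $\mathcal{H}_{n,i}$, $1\le i\le n$, of $C^1$ maps $h=(h_1,\ldots,h_n):\mathbb{R}^n\to\mathbb{R}^n$ are defined inductively: (1)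 $h\in\mathcal{H}_{n,1}$ if $h_2=h_3=\cdots=h_n=0$ and $h_1$ is independent of $x_1$. (2) For $1<i\le n$, write $v=(x_1,\ldots,x_i)$ and $z=(x_{i+1},\ldots,x_n)$ ($z$ is empty if $i=n$). Then $h\in\mathcal{H}_{n,i}$ if $h_{i+1}=\cdots=h_n=0$ and there exist a map $\widetilde h\in\mathcal{H}_{n,i-1}$, a $C^1$ map $T:\mathbb{R}^n\to\mathbb{R}^n$ of the form $T(v,z)=(B(z)v,z)$, where $B(z)$ is an $i\times i$ matrix whose entries depend only on $z$, and a map $C:\mathbb{R}^n\to\mathbb{R}^n$ whose components depend only on $z$, such that for all $x=(v,z)$ $$h(x)=\begin{bmatrix}\mathrm{adj}(B(z))&0\\0&I\end{bmatrix}\widetilde h(T(x))+C(z),$$ where the block matrix multiplies the vector $\widetilde h(T(x))$. Finally, $\mathcal{H}_n=\mathcal{H}_{n,n}$, and a $C^1$ map $f:\mathbb{R}^n\to\mathbb{R}^n$ is in the New Class if and only if it has the form $f(x)=x+h(x)$ with $h\in\mathcal{H}_n$. *)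

theory Defs
  imports "Jordan_Normal_Form.Determinant" "HOL-Analysis.Analysis"
begin

no_notation vec_index (infixl "$" 100)

text \<open>
  The space is \<open>real ^ 'n\<close> with \<open>n = CARD('n)\<close>. A coordinate numbering is a bijection
  \<open>p :: 'n \<Rightarrow> nat\<close> onto \<open>{..<n}\<close>; it is 0-based, as the matrices of type \<open>real mat\<close> are, so that
  \<open>x $ k\<close> is the coordinate usually written \<open>x\<^sub>j\<close> with \<open>j = p k + 1\<close>. For \<open>1 \<le> i \<le> n\<close> the splitting
  \<open>x = (v, z)\<close> is: \<open>v\<close> consists of the \<open>x $ k\<close> with \<open>p k < i\<close>, and \<open>z\<close> of those with \<open>i \<le> p k\<close>.
\<close>

definition C1_map :: "(real ^ 'n \<Rightarrow> real ^ 'n) \<Rightarrow> bool" where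
  "C1_map f \<longleftrightarrow>
     (\<forall>x. f differentiable (at x)) \<and> continuous_on UNIV (\<lambda>x. jacobian f (at x))"

definition depends_only_on_z :: "('n \<Rightarrow> nat) \<Rightarrow> nat \<Rightarrow> (real ^ 'n \<Rightarrow> 'b) \<Rightarrow> bool" where
  "depends_only_on_z p i F \<longleftrightarrow>
     (\<forall>x y. (\<forall>k. i \<le> p k \<longrightarrow> x $ k = y $ k) \<longrightarrow> F x = F y)"

text \<open>The block diagonal matrix with blocks \<open>M\<close> (of size \<open>i \<times> i\<close>) and \<open>I\<close>, applied to a vector.\<close>

definition block_apply :: "('n::finite \<Rightarrow> nat) \<Rightarrow> nat \<Rightarrow> real mat \<Rightarrow> real ^ 'n \<Rightarrow> real ^ 'n" where
  "block_apply p i M x =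
     (\<chi> k. if p k < i then (\<Sum>l | p l < i. M $$ (p k, p l) * x $ l) else x $ k)"

text \<open>
  \<open>in_H p i h\<close> means that \<open>h\<close> belongs to \<open>\<H>\<^bsub>n,i\<^esub>\<close>. The functions \<open>B\<close> and \<open>C\<close> of \<open>z\<close> are
  represented by functions of \<open>x = (v, z)\<close> that do not depend on \<open>v\<close>.
\<close>

inductive in_H :: "('n::finite \<Rightarrow> nat) \<Rightarrow> nat \<Rightarrow> (real ^ 'n \<Rightarrow> real ^ 'n) \<Rightarrow> bool"
  for p :: "'n \<Rightarrow> nat" where
  base: "in_H p 1 h"
    if "C1_map h"
    and "\<And>x k. 1 \<le> p k \<Longrightarrow> h x $ k = 0"
    and "\<And>k. p k = 0 \<Longrightarrow> depends_only_on_z p 1 (\<lambda>x. h x $ k)"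
| step: "in_H p i h"
    if "1 < i" and "i \<le> CARD('n)"
    and "C1_map h"
    and "\<And>x k. i \<le> p k \<Longrightarrow> h x $ k = 0"
    and "in_H p (i - 1) h'"
    and "\<And>x. B x \<in> carrier_mat i i" and "depends_only_on_z p i B"
    and "C1_map T" and "\<And>x. T x = block_apply p i (B x) x"
    and "depends_only_on_z p i C"
    and "\<And>x. h x = block_apply p i (adj_mat (B x)) (h' (T x)) + C x"

definition H_class :: "('n::finite \<Rightarrow> nat) \<Rightarrow> (real ^ 'n \<Rightarrow> real ^ 'n) set" where
  "H_class p = {h. in_H p CARD('n) h}"

definition new_class :: "('n::finite \<Rightarrow> nat) \<Rightarrow> (real ^ 'n \<Rightarrow> real ^ 'n) set" where
  "new_class p = {f. C1_map f \<and> (\<exists>h\<in>H_class p. \<forall>x. f x = x + h x)}"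

definition coord_matrix :: "('n::finite \<Rightarrow> nat) \<Rightarrow> (real ^ 'n \<Rightarrow> real ^ 'n) \<Rightarrow> real mat" where
  "coord_matrix p T =
     Matrix.mat CARD('n) CARD('n) (\<lambda>(a, b). matrix T $ (inv_into UNIV p a) $ (inv_into UNIV p b))"

definition adjugate_map ::
    "('n::finite \<Rightarrow> nat) \<Rightarrow> (real ^ 'n \<Rightarrow> real ^ 'n) \<Rightarrow> real ^ 'n \<Rightarrow> real ^ 'n" where
  "adjugate_map p T = block_apply p CARD('n) (adj_mat (coord_matrix p T))"

text \<open>
  The power \<open>M ^ k\<close> cannot be used here: on \<open>real ^ 'n ^ 'n\<close> it is taken entrywise.
\<close>

definition nilpotent_matrix :: "real ^ 'n ^ 'n \<Rightarrow> bool" where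
  "nilpotent_matrix M \<longleftrightarrow> (\<exists>k. (((**) M) ^^ k) (Finite_Cartesian_Product.mat 1) = 0)"

definition unipotent_matrix :: "real ^ 'n ^ 'n \<Rightarrow> bool" where
  "unipotent_matrix M \<longleftrightarrow> nilpotent_matrix (M - Finite_Cartesian_Product.mat 1)"

text \<open>
  The real-valued functions of \<open>y\<close> given by a finite formula built from real constants, the
  coordinates of \<open>y\<close>, the algebraic operations (arithmetic and extraction of roots) and the
  components of \<open>f\<close>, composed freely. A quotient or root is admitted only where it is meaningful
  for all \<open>y\<close>, so that the conventions for \<open>a / 0\<close> and \<open>root k\<close> of negative numbers play no role.
\<close>

inductive_set formula_functions :: "(real ^ 'n \<Rightarrow> real ^ 'n) \<Rightarrow> (real ^ 'n \<Rightarrow> real) set"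
  for f :: "real ^ 'n \<Rightarrow> real ^ 'n" where
  const: "(\<lambda>y. c) \<in> formula_functions f"
| coord: "(\<lambda>y. y $ k) \<in> formula_functions f"
| add: "(\<lambda>y. u y + w y) \<in> formula_functions f"
    if "u \<in> formula_functions f" and "w \<in> formula_functions f"
| diff: "(\<lambda>y. u y - w y) \<in> formula_functions f"
    if "u \<in> formula_functions f" and "w \<in> formula_functions f"
| mult: "(\<lambda>y. u y * w y) \<in> formula_functions f"
    if "u \<in> formula_functions f" and "w \<in> formula_functions f"
| divide: "(\<lambda>y. u y / w y) \<in> formula_functions f"
    if "u \<in> formula_functions f" and "w \<in> formula_functions f" and "\<And>y. w y \<noteq> 0"
| root: "(\<lambda>y. root m (u y)) \<in> formula_functions f"
    if "u \<in> formula_functions f" and "0 < m" and "\<And>y. even m \<Longrightarrow> 0 \<le> u y"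
| component: "(\<lambda>y. f (\<chi> k. g k y) $ j) \<in> formula_functions f"
    if "\<And>k. g k \<in> formula_functions f"

definition has_explicit_inverse :: "(real ^ 'n \<Rightarrow> real ^ 'n) \<Rightarrow> bool" where
  "has_explicit_inverse f \<longleftrightarrow>
     bij f \<and> (\<forall>k. (\<lambda>y. inv_into UNIV f y $ k) \<in> formula_functions f)"

end

theory Submission
  imports Defs "Jordan_Normal_Form.Char_Poly"
begin

no_notation vec_index (infixl "$" 100)

text \<open>
  Everything rests on the claim that \<open>h \<circ> \<dots> \<circ> h\<close> (\<open>n\<close> factors) is constant for every
  \<open>h\<close> in \<open>\<H>\<^sub>n\<close>, together with the stability of \<open>\<H>\<^sub>n\<close> under scaling and translation.

  To prove it by induction on the level \<open>i\<close>, freeze \<open>z\<close>: lemma \<open>funpow_frozen_map_H\<close> says that the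
  \<open>i\<close>-th iterate of \<open>(v, z) \<mapsto> (s h\<^sub>v(v, z) + d, z)\<close> forgets \<open>v\<close>. Write
  \<open>h = adj(B) h'(B v, z) + C\<close>. The substitution \<open>w = B v\<close> turns an orbit of this map into an orbit of
  \<open>w \<mapsto> s det(B) h'(w, z) + B (s C + d)\<close>, because \<open>B adj(B) = det(B) I\<close>. The last coordinate of \<open>h'\<close>
  vanishes, so after one step the last coordinate of \<open>w\<close> stays constant along the orbit, with a
  value that depends only on \<open>z\<close>, and can be counted as part of \<open>z\<close>; the induction hypothesis for \<open>h'\<close> then uses up the remaining \<open>i - 1\<close> steps.

  Two applications give nilpotence for \<open>h\<close> and invertibility for \<open>f\<close>. For nilpotence at \<open>x\<close>, translate
  \<open>h\<close> to a map \<open>g\<close> in \<open>\<H>\<^sub>n\<close> that fixes \<open>x\<close>. By the chain rule the derivative of the constant map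
  \<open>g\<^sup>n\<close> at the fixed point \<open>x\<close> is the \<open>n\<close>-th power of the derivative of \<open>h\<close> at \<open>x\<close>. For
  invertibility, solving \<open>f(x) = y\<close> means finding a fixed point of \<open>x \<mapsto> y - h(x)\<close>. This map lies in
  \<open>\<H>\<^sub>n\<close>, so its \<open>n\<close>-th iterate is a constant, which is its only fixed point. Hence \<open>f\<^sup>-\<^sup>1(y)\<close> is the
  \<open>n\<close>-th iterate of \<open>x \<mapsto> y - (f(x) - x)\<close> at \<open>0\<close>, a formula in the components of \<open>f\<close>.

  For \<open>n > 1\<close>, stability under \<open>h \<mapsto> T\<^sup>a \<circ> h \<circ> T\<close> replaces \<open>B\<close> by \<open>B T\<close> and comes down to
  \<open>adj(B T) = adj(T) adj(B)\<close>, for matrices that may be singular.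
\<close>

section \<open>The adjugate of a product\<close>

lemma adj_mat_mult_nonsingular:
  fixes A B :: "'a :: idom mat"
  assumes A: "A \<in> carrier_mat n n" and B: "B \<in> carrier_mat n n"
    and nz: "Determinant.det A \<noteq> 0" "Determinant.det B \<noteq> 0"
  shows "adj_mat (A * B) = adj_mat B * adj_mat A"
proof -
  let ?M = "A * B" and ?Y = "adj_mat B * adj_mat A"
  let ?d = "Determinant.det ?M"
  have M: "?M \<in> carrier_mat n n" using A B by simp
  note aA = adj_mat[OF A] and aB = adj_mat[OF B] and aM = adj_mat[OF M]
  have Y: "?Y \<in> carrier_mat n n" using aA(1) aB(1) by simp
  have d: "?d = Determinant.det A * Determinant.det B" by (rule Determinant.det_mult[OF A B])
  have "?M * ?Y = A * (B * ?Y)" using A B Y by (simp add: assoc_mult_mat[of _ n n _ n _ n])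
  also have "B * ?Y = (B * adj_mat B) * adj_mat A"
    using B aA(1) aB(1) by (simp add: assoc_mult_mat[of _ n n _ n _ n])
  also have "\<dots> = Determinant.det B \<cdot>\<^sub>m adj_mat A"
    unfolding aB(2) using aA(1) by (simp add: mult_smult_assoc_mat[of _ n n _ n])
  also have "A * \<dots> = Determinant.det B \<cdot>\<^sub>m (Determinant.det A \<cdot>\<^sub>m 1\<^sub>m n)"
    using A aA by (simp add: mult_smult_distrib[of _ n n _ n])
  also have "\<dots> = ?d \<cdot>\<^sub>m 1\<^sub>m n" unfolding d by (intro eq_matI) auto
  finally have MY: "?M * ?Y = ?d \<cdot>\<^sub>m 1\<^sub>m n" .
  have "?d \<cdot>\<^sub>m ?Y = (adj_mat ?M * ?M) * ?Y"
    unfolding aM(3) using Y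
    by (simp only: mult_smult_assoc_mat[of _ n n _ n] one_carrier_mat left_mult_one_mat)
  also have "\<dots> = adj_mat ?M * (?M * ?Y)"
    using aM(1) M Y by (simp add: assoc_mult_mat[of _ n n _ n _ n])
  also have "\<dots> = ?d \<cdot>\<^sub>m adj_mat ?M"
    unfolding MY using aM(1) by (simp add: mult_smult_distrib[of _ n n _ n])
  finally have eq: "?d \<cdot>\<^sub>m ?Y = ?d \<cdot>\<^sub>m adj_mat ?M" .
  have "?Y $$ (a, b) = adj_mat ?M $$ (a, b)" if "a < n" "b < n" for a b
  proof -
    have "(?d \<cdot>\<^sub>m ?Y) $$ (a, b) = ?d * ?Y $$ (a, b)"
      using that Y by (intro index_smult_mat(1)) (simp_all only: carrier_matD)
    moreover have "(?d \<cdot>\<^sub>m adj_mat ?M) $$ (a, b) = ?d * adj_mat ?M $$ (a, b)"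
      using that aM(1) by (intro index_smult_mat(1)) (simp_all only: carrier_matD)
    ultimately have "?d * ?Y $$ (a, b) = ?d * adj_mat ?M $$ (a, b)" using eq by metis
    then show ?thesis using nz unfolding d by (metis mult_cancel_left no_zero_divisors)
  qed
  then show ?thesis using Y aM(1) by (intro eq_matI) (simp_all only: carrier_matD)
qed

lemma (in comm_ring_hom) adj_mat_hom:
  assumes A: "A \<in> carrier_mat n n"
  shows "adj_mat (map_mat hom A) = map_mat hom (adj_mat A)"
proof -
  have del: "mat_delete (map_mat hom A) a b = map_mat hom (mat_delete A a b)"
    if "a < n" "b < n" for a b
    using A that by (intro eq_matI) (auto simp: mat_delete_def)
  have cof: "cofactor (map_mat hom A) a b = hom (cofactor A a b)" if "a < n" "b < n" for a b
    unfolding cofactor_def del[OF that] hom_det by (simp add: hom_mult hom_power hom_uminus)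
  show ?thesis
    by (intro eq_matI) (use A cof in \<open>simp_all add: adj_mat_def\<close>)
qed

text \<open>
  Singular factors are handled by passing to \<open>A + X I\<close> and \<open>B + X I\<close> over the polynomial ring: their
  determinants are monic in \<open>X\<close>, hence nonzero, and evaluation at \<open>X = 0\<close> recovers \<open>A\<close> and \<open>B\<close>.
\<close>

lemma adj_mat_mult:
  fixes A B :: "'a :: idom mat"
  assumes A: "A \<in> carrier_mat n n" and B: "B \<in> carrier_mat n n"
  shows "adj_mat (A * B) = adj_mat B * adj_mat A"
proof -
  have hom: "comm_ring_hom (\<lambda>q :: 'a poly. poly q 0)" "semiring_hom (\<lambda>q :: 'a poly. poly q 0)"
    by unfold_locales auto
  note ev_mult = semiring_hom.mat_hom_mult[OF hom(2)] and ev_adj = comm_ring_hom.adj_mat_hom[OF hom(1)]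
  let ?ev = "map_mat (\<lambda>q :: 'a poly. poly q 0)"
  let ?L = "\<lambda>M :: 'a mat. char_poly_matrix (- M)"
  have car: "?L M \<in> carrier_mat n n" if "M \<in> carrier_mat n n" for M
    using that by simp
  have nz: "Determinant.det (?L M) \<noteq> 0" if "M \<in> carrier_mat n n" for M
    using degree_monic_char_poly[of "- M" n] that unfolding char_poly_def by force
  have ev: "?ev (?L M) = M" if "M \<in> carrier_mat n n" for M
    using that by (intro eq_matI) (auto simp: char_poly_matrix_def)
  have LL: "?L A * ?L B \<in> carrier_mat n n" using car A B by (meson mult_carrier_mat)
  have "adj_mat (A * B) = adj_mat (?ev (?L A * ?L B))"
    using ev_mult[OF car[OF A] car[OF B]] ev A B by simp
  also have "\<dots> = ?ev (adj_mat (?L A * ?L B))" by (rule ev_adj[OF LL])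
  also have "\<dots> = ?ev (adj_mat (?L B) * adj_mat (?L A))"
    using adj_mat_mult_nonsingular[OF car[OF A] car[OF B] nz[OF A] nz[OF B]] by simp
  also have "\<dots> = ?ev (adj_mat (?L B)) * ?ev (adj_mat (?L A))"
    by (rule ev_mult[OF adj_mat(1)[OF car[OF B]] adj_mat(1)[OF car[OF A]]])
  also have "\<dots> = adj_mat B * adj_mat A"
    using ev_adj[OF car[OF A]] ev_adj[OF car[OF B]] ev A B by simp
  finally show ?thesis .
qed

section \<open>Continuously differentiable maps\<close>

lemma C1_map_compose:
  fixes f g :: "real ^ 'n \<Rightarrow> real ^ 'n"
  assumes f: "C1_map f" and g: "C1_map g"
  shows "C1_map (\<lambda>x. g (f x))"
proof -
  have der: "((\<lambda>x. g (f x)) has_derivative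
      (\<lambda>v. (jacobian g (at (f x)) ** jacobian f (at x)) *v v)) (at x)" for x
  proof -
    have "(f has_derivative (\<lambda>v. jacobian f (at x) *v v)) (at x)"
      and "(g has_derivative (\<lambda>v. jacobian g (at (f x)) *v v)) (at (f x))"
      using f g unfolding C1_map_def jacobian_works by auto
    from diff_chain_at[OF this] show ?thesis
      by (simp add: o_def matrix_vector_mul_assoc)
  qed
  have jac: "jacobian (\<lambda>x. g (f x)) (at x) = jacobian g (at (f x)) ** jacobian f (at x)" for x
    unfolding jacobian_def[of "\<lambda>x. g (f x)"] using frechet_derivative_at[OF der[of x]]
    by (metis matrix_of_matrix_vector_mul)
  have "continuous_on UNIV f"
    using f unfolding C1_map_def
    by (simp add: continuous_on_eq_continuous_at differentiable_imp_continuous_within)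
  then have "continuous_on UNIV (\<lambda>x. jacobian g (at (f x)))"
    using g continuous_on_compose2[of UNIV "\<lambda>x. jacobian g (at x)" UNIV f]
    unfolding C1_map_def by auto
  moreover have "continuous_on UNIV (\<lambda>x. jacobian f (at x))"
    using f unfolding C1_map_def by auto
  ultimately have "continuous_on UNIV (\<lambda>x. jacobian g (at (f x)) ** jacobian f (at x))"
    unfolding matrix_matrix_mult_def by (intro continuous_intros)
  then show ?thesis
    using der unfolding C1_map_def jac differentiable_def by blast
qed

lemma C1_map_affine:
  fixes L :: "real ^ 'n \<Rightarrow> real ^ 'n"
  assumes "linear L"
  shows "C1_map (\<lambda>x. L x + c)"
proof -
  have der: "((\<lambda>x. L x + c) has_derivative L) (at x)" for x
    using has_derivative_add_const[OF linear_imp_has_derivative[OF assms]] by simp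
  have "jacobian (\<lambda>x. L x + c) (at x) = matrix L" for x
    unfolding jacobian_def using frechet_derivative_at[OF der] by simp
  then show ?thesis
    using der unfolding C1_map_def differentiable_def by auto
qed

lemma C1_map_linear: "linear L \<Longrightarrow> C1_map L"
  using C1_map_affine[of L 0] by simp

lemma C1_map_scaleR: "C1_map h \<Longrightarrow> C1_map (\<lambda>x. r *\<^sub>R h x)"
  by (rule C1_map_compose[OF _ C1_map_linear]) (auto intro: linearI simp: algebra_simps)

lemma C1_map_translate: "C1_map h \<Longrightarrow> C1_map (\<lambda>x. h x + c)"
  using C1_map_compose[OF _ C1_map_affine[OF linear_id]] by simp

section \<open>Block matrices acting on vectors\<close>

abbreviation same_z :: "('n \<Rightarrow> nat) \<Rightarrow> nat \<Rightarrow> real ^ 'n \<Rightarrow> real ^ 'n \<Rightarrow> bool" where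
  "same_z p i x y \<equiv> (\<forall>k. i \<le> p k \<longrightarrow> x $ k = y $ k)"

lemma block_apply_scaleR: "block_apply p i M (r *\<^sub>R x) = r *\<^sub>R block_apply p i M x"
  by (simp add: block_apply_def vec_eq_iff sum_distrib_left algebra_simps)

lemma block_apply_add: "block_apply p i M (x + y) = block_apply p i M x + block_apply p i M y"
  by (simp add: block_apply_def vec_eq_iff sum.distrib algebra_simps)

lemma linear_block_apply: "linear (block_apply p i M)"
  by (intro linearI block_apply_add block_apply_scaleR)

lemma block_apply_cong_block:
  assumes "\<And>l. p l < i \<Longrightarrow> x $ l = y $ l" and "p k < i"
  shows "block_apply p i M x $ k = block_apply p i M y $ k"
  using assms by (simp add: block_apply_def)

lemma bij_betw_coordinates_below:
  fixes p :: "'n::finite \<Rightarrow> nat"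
  assumes "bij_betw p UNIV {..<CARD('n)}" and "i \<le> CARD('n)"
  shows "bij_betw p {l. p l < i} {..<i}"
proof (rule bij_betw_subset[OF assms(1)])
  show "p ` {l. p l < i} = {..<i}"
  proof (intro equalityI subsetI)
    fix b assume b: "b \<in> {..<i}"
    then have "b \<in> p ` UNIV" using assms unfolding bij_betw_def by auto
    then show "b \<in> p ` {l. p l < i}" using b by auto
  qed auto
qed simp

lemma sum_coordinates_below:
  fixes p :: "'n::finite \<Rightarrow> nat"
  assumes "bij_betw p UNIV {..<CARD('n)}" and "i \<le> CARD('n)"
  shows "(\<Sum>l | p l < i. g (p l)) = (\<Sum>b<i. g b)"
  by (rule sum.reindex_bij_betw[OF bij_betw_coordinates_below[OF assms]])

lemma block_apply_mult:
  fixes p :: "'n::finite \<Rightarrow> nat"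
  assumes p: "bij_betw p UNIV {..<CARD('n)}" and i: "i \<le> CARD('n)"
    and M: "M \<in> carrier_mat i i" and N: "N \<in> carrier_mat i i"
  shows "block_apply p i M (block_apply p i N x) = block_apply p i (M * N) x"
proof (unfold vec_eq_iff, intro allI)
  fix k
  show "block_apply p i M (block_apply p i N x) $ k = block_apply p i (M * N) x $ k"
  proof (cases "p k < i")
    case True
    have entry: "(M * N) $$ (p k, p m) = (\<Sum>l | p l < i. M $$ (p k, p l) * N $$ (p l, p m))"
      if "p m < i" for m
      using True that M N sum_coordinates_below[OF p i, of "\<lambda>b. M $$ (p k, b) * N $$ (b, p m)"]
      by (simp add: scalar_prod_def atLeast0LessThan)
    have "block_apply p i M (block_apply p i N x) $ k
        = (\<Sum>l | p l < i. \<Sum>m | p m < i. M $$ (p k, p l) * (N $$ (p l, p m) * x $ m))"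
      using True by (simp add: block_apply_def sum_distrib_left)
    also have "\<dots> = (\<Sum>m | p m < i. \<Sum>l | p l < i. M $$ (p k, p l) * (N $$ (p l, p m) * x $ m))"
      by (rule sum.swap)
    also have "\<dots> = (\<Sum>m | p m < i. (M * N) $$ (p k, p m) * x $ m)"
      by (intro sum.cong refl) (simp add: entry sum_distrib_right mult.assoc)
    also have "\<dots> = block_apply p i (M * N) x $ k" using True by (simp add: block_apply_def)
    finally show ?thesis .
  qed (simp add: block_apply_def)
qed

lemma block_apply_smult_one:
  fixes p :: "'n::finite \<Rightarrow> nat"
  assumes p: "bij_betw p UNIV {..<CARD('n)}" and "p k < i"
  shows "block_apply p i (c \<cdot>\<^sub>m 1\<^sub>m i) x $ k = c * x $ k"
proof -
  have inj: "p k = p l \<longleftrightarrow> k = l" for l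
    using p unfolding bij_betw_def inj_on_def by auto
  have "block_apply p i (c \<cdot>\<^sub>m 1\<^sub>m i) x $ k
      = (\<Sum>l | p l < i. (c \<cdot>\<^sub>m 1\<^sub>m i) $$ (p k, p l) * x $ l)"
    using assms(2) by (simp add: block_apply_def)
  also have "\<dots> = (\<Sum>l | p l < i. if k = l then c * x $ l else 0)"
    by (intro sum.cong refl) (use assms(2) in \<open>simp add: inj\<close>)
  also have "\<dots> = c * x $ k" using assms(2) by (simp add: sum.delta)
  finally show ?thesis .
qed

lemma block_apply_coord_matrix:
  fixes p :: "'n::finite \<Rightarrow> nat"
  assumes p: "bij_betw p UNIV {..<CARD('n)}" and T: "linear T"
  shows "block_apply p CARD('n) (coord_matrix p T) x = T x"
proof -
  have lt: "p k < CARD('n)" for k using p unfolding bij_betw_def by auto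
  have inv: "inv_into UNIV p (p k) = k" for k
    using p unfolding bij_betw_def by (simp add: inv_into_f_f)
  have "block_apply p CARD('n) (coord_matrix p T) x = matrix T *v x"
    by (simp add: block_apply_def coord_matrix_def vec_eq_iff lt inv matrix_vector_mult_def)
  then show ?thesis using matrix_works[of T x] T by (simp add: linear_def scalar_mult_eq_scaleR)
qed

section \<open>Operations that preserve the classes\<close>

lemma in_H_C1: "in_H p i h \<Longrightarrow> C1_map h"
  by (induction rule: in_H.induct) assumption+

lemma in_H_zero: "in_H p i h \<Longrightarrow> i \<le> p k \<Longrightarrow> h x $ k = 0"
  by (erule in_H.cases) auto

lemma in_H_scaleR:
  assumes "in_H p i h"
  shows "in_H p i (\<lambda>x. r *\<^sub>R h x)"
  using assms
proof (induction rule: in_H.induct)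
  case (base h)
  then show ?case
    by (intro in_H.base C1_map_scaleR) (auto simp: depends_only_on_z_def)
next
  case (step i h h' B T C)
  show ?case
  proof (rule in_H.step[where h' = "\<lambda>x. r *\<^sub>R h' x" and B = B and T = T and C = "\<lambda>x. r *\<^sub>R C x"])
    show "C1_map (\<lambda>x. r *\<^sub>R h x)" by (rule C1_map_scaleR[OF step.hyps(3)])
    show "depends_only_on_z p i (\<lambda>x. r *\<^sub>R C x)"
      using step.hyps(10) unfolding depends_only_on_z_def by metis
    show "r *\<^sub>R h x = block_apply p i (adj_mat (B x)) (r *\<^sub>R h' (T x)) + r *\<^sub>R C x" for x
      using step.hyps(11) by (simp add: block_apply_scaleR scaleR_add_right)
    show "(r *\<^sub>R h x) $ k = 0" if "i \<le> p k" for x k using step.hyps(4) that by simp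
  qed (rule step.hyps step.IH)+
qed

lemma depends_only_on_z_all:
  fixes p :: "'n::finite \<Rightarrow> nat"
  assumes p: "bij_betw p UNIV {..<CARD('n)}"
  shows "depends_only_on_z p CARD('n) F \<longleftrightarrow> (\<forall>x y. F x = F y)"
proof -
  have "\<not> CARD('n) \<le> p k" for k using p unfolding bij_betw_def by (auto simp: not_le)
  then show ?thesis by (simp add: depends_only_on_z_def)
qed

lemma in_H_translate:
  fixes p :: "'n::finite \<Rightarrow> nat"
  assumes p: "bij_betw p UNIV {..<CARD('n)}" and h: "in_H p CARD('n) h"
  shows "in_H p CARD('n) (\<lambda>x. h x + c)"
proof -
  have lt: "\<not> CARD('n) \<le> p k" for k using p unfolding bij_betw_def by (auto simp: not_le)
  note C1 = C1_map_translate[OF in_H_C1[OF h], of c]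
  from h show ?thesis
  proof (cases rule: in_H.cases)
    case base
    have "in_H p 1 (\<lambda>x. h x + c)"
      using base(1) base(4) lt
      by (intro in_H.base C1) (auto simp: depends_only_on_z_def)
    then show ?thesis using base by simp
  next
    case (step h' B T C)
    show ?thesis
    proof (rule in_H.step[where h' = h' and B = B and T = T and C = "\<lambda>x. C x + c"])
      show "depends_only_on_z p CARD('n) (\<lambda>x. C x + c)"
        using step(10) unfolding depends_only_on_z_all[OF p] by metis
      show "h x + c = block_apply p CARD('n) (adj_mat (B x)) (h' (T x)) + (C x + c)" for x
        using step(11) by simp
    qed (rule step(1,2,5-9) C1 | simp add: lt)+
  qed
qed

lemma in_H_conjugate:
  fixes p :: "'n::finite \<Rightarrow> nat"
  assumes p: "bij_betw p UNIV {..<CARD('n)}" and h: "in_H p CARD('n) h" and T: "linear T"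
  shows "in_H p CARD('n) (adjugate_map p T \<circ> h \<circ> T)"
proof -
  let ?n = "CARD('n)"
  have lt: "\<not> ?n \<le> p k" for k using p unfolding bij_betw_def by (auto simp: not_le)
  define A where "A = coord_matrix p T"
  have A: "A \<in> carrier_mat ?n ?n" by (simp add: A_def coord_matrix_def)
  have TA: "T x = block_apply p ?n A x" for x
    unfolding A_def by (rule block_apply_coord_matrix[OF p T, symmetric])
  have adjA: "adjugate_map p T x = block_apply p ?n (adj_mat A) x" for x
    by (simp add: adjugate_map_def A_def)
  have lin: "linear (adjugate_map p T)"
    unfolding adjugate_map_def by (rule linear_block_apply)
  have C1: "C1_map (adjugate_map p T \<circ> h \<circ> T)"
    unfolding o_def
    by (rule C1_map_compose[OF C1_map_linear[OF T]
          C1_map_compose[OF in_H_C1[OF h] C1_map_linear[OF lin]]])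
  from h show ?thesis
  proof (cases rule: in_H.cases)
    case base
    \<comment> \<open>Here \<open>n = 1\<close>, so \<open>h\<close> is constant.\<close>
    have "h x = h y" for x y
      using base(1,4) lt unfolding depends_only_on_z_def vec_eq_iff
      by (metis less_one not_le)
    then have "depends_only_on_z p 1 (\<lambda>x. (adjugate_map p T \<circ> h \<circ> T) x $ k)" for k
      unfolding depends_only_on_z_def by (metis o_apply)
    then have "in_H p 1 (adjugate_map p T \<circ> h \<circ> T)"
      using base(1) lt by (intro in_H.base C1) auto
    then show ?thesis using base by simp
  next
    case (step h' B T' C)
    have B_const: "B x = B y" and C_const: "C x = C y" for x y
      using step(7,10) unfolding depends_only_on_z_all[OF p] by auto
    show ?thesis
    proof (rule in_H.step[where h' = h' and B = "\<lambda>x. B x * A" and T = "\<lambda>x. T' (T x)"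
          and C = "\<lambda>x. adjugate_map p T (C x)"])
      show "B x * A \<in> carrier_mat ?n ?n" for x by (rule mult_carrier_mat[OF step(6) A])
      show "depends_only_on_z p ?n (\<lambda>x. B x * A)"
        and "depends_only_on_z p ?n (\<lambda>x. adjugate_map p T (C x))"
        unfolding depends_only_on_z_all[OF p] using B_const C_const by metis+
      show "C1_map (\<lambda>x. T' (T x))" by (rule C1_map_compose[OF C1_map_linear[OF T] step(8)])
      show "T' (T x) = block_apply p ?n (B x * A) x" for x
        unfolding step(9) B_const[of "T x" x] unfolding TA
        by (rule block_apply_mult[OF p order_refl step(6) A])
      show "(adjugate_map p T \<circ> h \<circ> T) x
          = block_apply p ?n (adj_mat (B x * A)) (h' (T' (T x))) + adjugate_map p T (C x)" for x
      proof -
        have "(adjugate_map p T \<circ> h \<circ> T) x = adjugate_map p T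
            (block_apply p ?n (adj_mat (B x)) (h' (T' (T x))) + C x)"
          using step(11) B_const[of "T x" x] C_const[of "T x" x] by simp
        also have "\<dots> = block_apply p ?n (adj_mat A) (block_apply p ?n (adj_mat (B x)) (h' (T' (T x))))
            + adjugate_map p T (C x)"
          by (simp add: adjA block_apply_add)
        also have "block_apply p ?n (adj_mat A) (block_apply p ?n (adj_mat (B x)) (h' (T' (T x))))
            = block_apply p ?n (adj_mat A * adj_mat (B x)) (h' (T' (T x)))"
          by (rule block_apply_mult[OF p order_refl adj_mat(1)[OF A] adj_mat(1)[OF step(6)]])
        also have "adj_mat A * adj_mat (B x) = adj_mat (B x * A)"
          by (rule adj_mat_mult[OF step(6) A, symmetric])
        finally show ?thesis .
      qed
    qed (rule step(1,2,5) C1 | simp add: lt)+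
  qed
qed

section \<open>Iterates become constant\<close>

text \<open>
  Iterating \<open>h\<close> itself would in general leave the fibre of a given \<open>z\<close>, because \<open>h\<close> replaces \<open>z\<close> by \<open>0\<close>.
\<close>

definition frozen_map ::
    "('n::finite \<Rightarrow> nat) \<Rightarrow> nat \<Rightarrow> real \<Rightarrow> real ^ 'n \<Rightarrow> (real ^ 'n \<Rightarrow> real ^ 'n) \<Rightarrow> real ^ 'n \<Rightarrow> real ^ 'n"
  where "frozen_map p i s d h x = (\<chi> k. if p k < i then s * h x $ k + d $ k else x $ k)"

lemma same_z_funpow_frozen_map: "i \<le> p k \<Longrightarrow> (frozen_map p i s d h ^^ m) x $ k = x $ k"
  by (induction m) (auto simp: frozen_map_def)

text \<open>
  The substitution \<open>w = B v\<close> at fixed \<open>z\<close>, where \<open>B\<close> and \<open>C\<close> are constants. It turns the factor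
  \<open>adj(B)\<close> into \<open>B adj(B) = det(B) I\<close>, which leaves \<open>h'\<close> multiplied by a mere scalar.
\<close>

lemma frozen_map_semiconjugate:
  fixes p :: "'n::finite \<Rightarrow> nat"
  assumes p: "bij_betw p UNIV {..<CARD('n)}" and i: "i \<le> CARD('n)" and B: "B \<in> carrier_mat i i"
    and h: "h x = block_apply p i (adj_mat B) (h' (block_apply p i B x)) + c"
  shows "block_apply p i B (frozen_map p i s d h x)
    = frozen_map p i (Determinant.det B * s) (block_apply p i B (s *\<^sub>R c + d)) h' (block_apply p i B x)"
proof (unfold vec_eq_iff, intro allI)
  fix k
  let ?w = "block_apply p i B x"
  let ?u = "s *\<^sub>R block_apply p i (adj_mat B) (h' ?w) + (s *\<^sub>R c + d)"
  show "block_apply p i B (frozen_map p i s d h x) $ k = frozen_map p i (Determinant.det B * s)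
      (block_apply p i B (s *\<^sub>R c + d)) h' ?w $ k"
  proof (cases "p k < i")
    case True
    have "block_apply p i B (frozen_map p i s d h x) $ k = block_apply p i B ?u $ k"
      using True by (intro block_apply_cong_block) (auto simp: frozen_map_def h algebra_simps)
    also have "\<dots> = s * block_apply p i (B * adj_mat B) (h' ?w) $ k
        + block_apply p i B (s *\<^sub>R c + d) $ k"
      using block_apply_mult[OF p i B adj_mat(1)[OF B]]
      by (simp add: block_apply_add block_apply_scaleR)
    also have "\<dots> = s * (Determinant.det B * h' ?w $ k) + block_apply p i B (s *\<^sub>R c + d) $ k"
      unfolding adj_mat(2)[OF B] block_apply_smult_one[OF p True] ..
    finally show ?thesis using True by (simp add: frozen_map_def)
  qed (simp add: frozen_map_def block_apply_def)
qed

text \<open>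
  The reason why the last coordinate of \<open>v\<close> can be counted as part of \<open>z\<close> after one step: there \<open>h\<close>
  vanishes, so the frozen map of level \<open>Suc j\<close> sets this coordinate to its value in \<open>d\<close>; the frozen
  map of level \<open>j\<close> keeps it, so the two maps agree wherever it already has that value.
\<close>

lemma funpow_frozen_map_lower_level:
  assumes zero: "\<And>x k. j \<le> p k \<Longrightarrow> h x $ k = 0"
    and last: "\<And>k. p k = j \<Longrightarrow> w $ k = d $ k"
  shows "(frozen_map p (Suc j) s d h ^^ m) w = (frozen_map p j s d h ^^ m) w"
proof (induction m)
  case (Suc m)
  let ?u = "(frozen_map p j s d h ^^ m) w"
  have "?u $ k = d $ k" if "p k = j" for k
    using same_z_funpow_frozen_map[of j p k] last that by fastforce
  then have "frozen_map p (Suc j) s d h ?u = frozen_map p j s d h ?u"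
    using zero by (auto simp: frozen_map_def vec_eq_iff less_Suc_eq)
  then show ?case using Suc by simp
qed simp

text \<open>
  The parameters \<open>s\<close> and \<open>d\<close> are there for the induction: the substitution \<open>w = B v\<close> multiplies
  \<open>h'\<close> by \<open>det(B)\<close> and adds a constant. After \<open>i\<close> steps it determines \<open>w\<close>, which for singular \<open>B\<close>
  is not enough to determine \<open>v\<close>. It is enough to know \<open>h'(w)\<close> one step earlier: if
  \<open>s det(B) \<noteq> 0\<close>, then \<open>h'(w)\<close> can be read off from the next \<open>w\<close>; otherwise \<open>w\<close> is
  already determined by \<open>z\<close> after one step, and there are \<open>i - 1 \<ge> 1\<close> steps before the last.
\<close>

lemma funpow_frozen_map_H:
  fixes p :: "'n::finite \<Rightarrow> nat"
  assumes p: "bij_betw p UNIV {..<CARD('n)}" and h: "in_H p i h"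
  shows "depends_only_on_z p i (frozen_map p i s d h ^^ i)"
  using h
proof (induction arbitrary: s d rule: in_H.induct)
  case (base h)
  show ?case
    unfolding depends_only_on_z_def
  proof (intro allI impI)
    fix x y assume xy: "same_z p 1 x y"
    have "h x $ k = h y $ k" if "p k < 1" for k
      using base(3)[of k] that xy unfolding depends_only_on_z_def by simp
    then show "(frozen_map p 1 s d h ^^ 1) x = (frozen_map p 1 s d h ^^ 1) y"
      using xy by (auto simp: frozen_map_def vec_eq_iff)
  qed
next
  case (step i h h' B T C)
  obtain j where j: "i = Suc j" "0 < j"
    using step.hyps(1) by (cases i) auto
  show ?case
    unfolding depends_only_on_z_def
  proof (intro allI impI)
    fix x y assume xy: "same_z p i x y"
    define T0 where "T0 = block_apply p i (B x)"
    define \<delta> where "\<delta> = Determinant.det (B x) * s"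
    define e where "e = T0 (s *\<^sub>R C x + d)"
    define G where "G = frozen_map p i s d h"
    define K where "K = frozen_map p i \<delta> e h'"
    have zero: "h' u $ k = 0" if "j \<le> p k" for u k
      using in_H_zero[OF step.hyps(5)] that j by simp
    have h_eq: "h u = block_apply p i (adj_mat (B x)) (h' (T0 u)) + C x"
      if "same_z p i u x" for u
    proof -
      have "B u = B x" "C u = C x"
        using step.hyps(7,10) that unfolding depends_only_on_z_def by blast+
      then show ?thesis using step.hyps(9,11) by (simp add: T0_def)
    qed
    have orbit: "same_z p i ((G ^^ m) u) x" if "same_z p i u x" for m u
      unfolding G_def using that same_z_funpow_frozen_map[of i p] by auto
    have semiconj: "T0 ((G ^^ m) u) = (K ^^ m) (T0 u)" if u: "same_z p i u x" for m u
    proof (induction m)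
      case (Suc m)
      have "T0 (G ((G ^^ m) u)) = K (T0 ((G ^^ m) u))"
        unfolding G_def K_def T0_def \<delta>_def e_def
        by (rule frozen_map_semiconjugate[OF p step.hyps(2,6)])
          (rule h_eq[OF orbit[OF u], unfolded T0_def G_def])
      then show ?case using Suc by simp
    qed simp
    have T0z: "T0 u $ k = u $ k" if "i \<le> p k" for u k
      using that by (simp add: T0_def block_apply_def)
    have last: "K u $ k = e $ k" if "p k = j" for u k
      using that zero by (simp add: K_def frozen_map_def j)
    have Kxy: "same_z p j (K (T0 x)) (K (T0 y))"
    proof (intro allI impI)
      fix k assume k: "j \<le> p k"
      show "K (T0 x) $ k = K (T0 y) $ k"
      proof (cases "p k = j")
        case False
        then have "i \<le> p k" using k j by simp
        then show ?thesis using xy T0z by (simp add: K_def frozen_map_def)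
      qed (simp add: last)
    qed
    have "h' ((K ^^ j) (T0 x)) = h' ((K ^^ j) (T0 y))"
    proof (cases "\<delta> = 0")
      case True
      have "K (T0 x) = K (T0 y)"
        using xy T0z True by (auto simp: K_def frozen_map_def vec_eq_iff)
      moreover have "(K ^^ j) u = (K ^^ (j - 1)) (K u)" for u
        using j(2) by (cases j) (auto simp: funpow_swap1)
      ultimately show ?thesis by simp
    next
      case False
      have lower: "(K ^^ i) u = (frozen_map p j \<delta> e h' ^^ j) (K u)" for u
      proof -
        have "(K ^^ i) u = (K ^^ j) (K u)" using j by (simp add: funpow_swap1)
        also have "\<dots> = (frozen_map p j \<delta> e h' ^^ j) (K u)"
          unfolding K_def j(1)
          using last by (intro funpow_frozen_map_lower_level zero) (auto simp: K_def j(1))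
        finally show ?thesis .
      qed
      have "(K ^^ i) (T0 x) = (K ^^ i) (T0 y)"
        using step.IH[of \<delta> e] Kxy j unfolding lower depends_only_on_z_def by simp
      then have eq: "K ((K ^^ j) (T0 x)) = K ((K ^^ j) (T0 y))" using j by simp
      show ?thesis
      proof (unfold vec_eq_iff, intro allI)
        fix k
        show "h' ((K ^^ j) (T0 x)) $ k = h' ((K ^^ j) (T0 y)) $ k"
        proof (cases "p k < i")
          case True
          then show ?thesis
            using arg_cong[OF eq, of "\<lambda>v. v $ k"] False by (simp add: K_def frozen_map_def)
        next
          case False
          then show ?thesis using zero j by simp
        qed
      qed
    qed
    moreover have xx: "same_z p i x x" and yx: "same_z p i y x" using xy by simp_all
    ultimately have "h ((G ^^ j) x) = h ((G ^^ j) y)"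
      by (simp add: h_eq[OF orbit] semiconj)
    moreover have "(G ^^ j) x $ k = (G ^^ j) y $ k" if "i \<le> p k" for k
      using orbit[OF xx] orbit[OF yx] that by simp
    ultimately have "G ((G ^^ j) x) = G ((G ^^ j) y)"
      by (simp add: G_def frozen_map_def vec_eq_iff)
    then show "(frozen_map p i s d h ^^ i) x = (frozen_map p i s d h ^^ i) y"
      using j by (simp add: G_def)
  qed
qed

lemma H_funpow_constant:
  fixes p :: "'n::finite \<Rightarrow> nat"
  assumes p: "bij_betw p UNIV {..<CARD('n)}" and h: "in_H p CARD('n) h"
  shows "(h ^^ CARD('n)) x = (h ^^ CARD('n)) y"
proof -
  have "p k < CARD('n)" for k using p unfolding bij_betw_def by auto
  then have "frozen_map p CARD('n) 1 0 h = h"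
    by (simp add: frozen_map_def fun_eq_iff vec_eq_iff)
  then show ?thesis
    using funpow_frozen_map_H[OF p h, of 1 0] unfolding depends_only_on_z_all[OF p] by simp
qed

section \<open>Nilpotence of the Jacobian\<close>

lemma has_derivative_funpow_at_fixed_point:
  assumes g: "(g has_derivative D) (at x)" and fixed: "g x = x"
  shows "((g ^^ m) has_derivative (D ^^ m)) (at x)"
proof (induction m)
  case (Suc m)
  have "(g ^^ m) x = x" using fixed by (induction m) auto
  then have "((g \<circ> (g ^^ m)) has_derivative (D \<circ> (D ^^ m))) (at x)"
    using diff_chain_at[OF Suc] g by simp
  then show ?case by (simp only: funpow.simps)
qed (simp add: id_def)

lemma matrix_funpow:
  fixes D :: "real ^ 'n \<Rightarrow> real ^ 'n"
  assumes "linear D"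
  shows "linear (D ^^ m)"
    and "matrix (D ^^ m) = (((**) (matrix D)) ^^ m) (Finite_Cartesian_Product.mat 1)"
proof (induction m)
  case 0
  case 1
  show ?case using linear_id by (simp add: id_def)
  case 2
  show ?case using matrix_id_mat_1 by (simp add: id_def)
next
  case (Suc m)
  case 1
  show ?case using linear_compose[OF Suc(1) assms] by (simp add: o_def)
  case 2
  show ?case using matrix_compose[OF Suc(1) assms] Suc(2) by (simp add: o_def)
qed

text \<open>
  Iterates of \<open>h\<close> have products of Jacobians at different points as derivatives. Translating \<open>h\<close>
  does not change its Jacobian, and once \<open>x\<close> is a fixed point all factors are equal.
\<close>

lemma H_jacobian_nilpotent:
  fixes p :: "'n::finite \<Rightarrow> nat"
  assumes p: "bij_betw p UNIV {..<CARD('n)}" and h: "in_H p CARD('n) h"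
  shows "nilpotent_matrix (jacobian h (at x))"
proof -
  let ?n = "CARD('n)"
  define g where "g u = h u + (x - h x)" for u
  define D where "D = frechet_derivative h (at x)"
  have hD: "(h has_derivative D) (at x)"
    using in_H_C1[OF h] unfolding C1_map_def D_def by (simp add: frechet_derivative_works)
  have "(g has_derivative D) (at x)"
    unfolding g_def by (rule has_derivative_add_const[OF hD])
  then have "((g ^^ ?n) has_derivative (D ^^ ?n)) (at x)"
    by (rule has_derivative_funpow_at_fixed_point) (simp add: g_def)
  moreover have "in_H p ?n g" unfolding g_def by (rule in_H_translate[OF p h])
  then have "g ^^ ?n = (\<lambda>_. (g ^^ ?n) x)" using H_funpow_constant[OF p] by blast
  then have "((g ^^ ?n) has_derivative (\<lambda>_. 0)) (at x)"
    by (metis has_derivative_const)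
  ultimately have "D ^^ ?n = (\<lambda>_. 0)" by (rule has_derivative_unique)
  then have "(((**) (matrix D)) ^^ ?n) (Finite_Cartesian_Product.mat 1) = 0"
    using matrix_funpow(2)[OF has_derivative_linear[OF hD], of ?n]
    by (simp add: matrix_def vec_eq_iff)
  then show ?thesis unfolding nilpotent_matrix_def jacobian_def D_def by blast
qed

section \<open>The explicit inverse\<close>

text \<open>
  The map \<open>u \<mapsto> y - h(u)\<close> again belongs to \<open>\<H>\<^sub>n\<close>. The constant value of its \<open>n\<close>-th iterate is a
  fixed point, since the map commutes with its iterate, and every fixed point is equal to it. The
  starting point \<open>0\<close> is an arbitrary choice.
\<close>

lemma H_reflected_fixed_point:
  fixes p :: "'n::finite \<Rightarrow> nat" and y :: "real ^ 'n"
  assumes p: "bij_betw p UNIV {..<CARD('n)}" and h: "in_H p CARD('n) h"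
  shows "x + h x = y \<longleftrightarrow> x = ((\<lambda>u. y - h u) ^^ CARD('n)) 0"
proof -
  let ?n = "CARD('n)" and ?g = "\<lambda>u. y - h u"
  have "?g = (\<lambda>u. (-1) *\<^sub>R h u + y)" by auto
  then have "in_H p ?n ?g"
    using in_H_translate[OF p in_H_scaleR[OF h, of "-1"], of y] by simp
  note const = H_funpow_constant[OF p this]
  show ?thesis
  proof
    assume "x + h x = y"
    then have "?g x = x" by (auto simp: algebra_simps)
    then have "(?g ^^ m) x = x" for m by (induction m) auto
    then show "x = (?g ^^ ?n) 0" using const[of x 0] by simp
  next
    assume x: "x = (?g ^^ ?n) 0"
    have "?g x = (?g ^^ ?n) (?g 0)" unfolding x by (rule funpow_swap1)
    also have "\<dots> = x" unfolding x by (rule const)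
    finally show "x + h x = y" by (auto simp: algebra_simps)
  qed
qed

lemma formula_functions_iterate:
  fixes f h :: "real ^ 'n \<Rightarrow> real ^ 'n"
  assumes f: "\<And>x. f x = x + h x"
  shows "(\<lambda>y. ((\<lambda>u. y - h u) ^^ m) 0 $ k) \<in> formula_functions f"
proof (induction m arbitrary: k)
  case 0
  show ?case using formula_functions.const[of 0 f] by simp
next
  case (Suc m)
  define u where "u y = ((\<lambda>u. y - h u) ^^ m) 0" for y
  have u: "(\<lambda>y. u y $ l) \<in> formula_functions f" for l
    unfolding u_def by (rule Suc)
  have "(\<lambda>y. f (\<chi> l. u y $ l) $ k) \<in> formula_functions f"
    by (rule formula_functions.component[OF u])
  then have "(\<lambda>y. y $ k - (f (u y) $ k - u y $ k)) \<in> formula_functions f"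
    using u by (intro formula_functions.diff formula_functions.coord) auto
  moreover have "y $ k - (f (u y) $ k - u y $ k) = ((\<lambda>u. y - h u) ^^ Suc m) 0 $ k" for y
    by (simp add: f u_def)
  ultimately show ?case by simp
qed

lemma H_explicit_inverse:
  fixes p :: "'n::finite \<Rightarrow> nat"
  assumes p: "bij_betw p UNIV {..<CARD('n)}" and h: "in_H p CARD('n) h"
    and f: "\<And>x. f x = x + h x"
  shows "has_explicit_inverse f"
proof -
  have sol: "f x = y \<longleftrightarrow> x = ((\<lambda>u. y - h u) ^^ CARD('n)) 0" for x y
    unfolding f by (rule H_reflected_fixed_point[OF p h])
  have bij: "bij f" unfolding bij_iff using sol by auto
  then have "inv_into UNIV f y = ((\<lambda>u. y - h u) ^^ CARD('n)) 0" for y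
    using sol bij_inv_eq_iff by metis
  then show ?thesis
    unfolding has_explicit_inverse_def using bij formula_functions_iterate[of f h] f by simp
qed

theorem theorem9p1:
  fixes p :: "'n::finite \<Rightarrow> nat" and f h :: "real ^ 'n \<Rightarrow> real ^ 'n"
  assumes "bij_betw p UNIV {..<CARD('n)}"
    and "f \<in> new_class p" and "\<And>x. f x = x + h x"
  shows "(\<forall>r::real. (\<lambda>x. r *\<^sub>R h x) \<in> H_class p)
    \<and> (\<forall>T. linear T \<longrightarrow> adjugate_map p T \<circ> h \<circ> T \<in> H_class p)
    \<and> (\<forall>C. (\<lambda>x. h x + C) \<in> H_class p)
    \<and> (\<forall>x. nilpotent_matrix (jacobian h (at x)))
    \<and> (\<forall>x. unipotent_matrix (jacobian f (at x)))
    \<and> (\<exists>c. \<forall>x. (h ^^ CARD('n)) x = c)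
    \<and> bij f \<and> has_explicit_inverse f"
proof -
  note p = assms(1)
  obtain h0 where "h0 \<in> H_class p" "\<And>x. f x = x + h0 x"
    using assms(2) unfolding new_class_def by blast
  moreover from this have "h0 = h" using assms(3) by (metis add_left_cancel ext)
  ultimately have h: "in_H p CARD('n) h" by (simp add: H_class_def)
  have "jacobian f (at x) - Finite_Cartesian_Product.mat 1 = jacobian h (at x)" for x
  proof -
    have "(h has_derivative (\<lambda>v. jacobian h (at x) *v v)) (at x)"
      using in_H_C1[OF h] unfolding C1_map_def jacobian_works by blast
    then have "(f has_derivative
        (\<lambda>v. (Finite_Cartesian_Product.mat 1 + jacobian h (at x)) *v v)) (at x)"
      using has_derivative_add[OF has_derivative_ident] ext[of f "\<lambda>x. x + h x", OF assms(3)]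
      by (simp add: matrix_vector_mult_add_rdistrib)
    then have "jacobian f (at x) = Finite_Cartesian_Product.mat 1 + jacobian h (at x)"
      unfolding jacobian_def[of f] using frechet_derivative_at
      by (metis matrix_of_matrix_vector_mul)
    then show ?thesis by simp
  qed
  then have "unipotent_matrix (jacobian f (at x))" for x
    unfolding unipotent_matrix_def using H_jacobian_nilpotent[OF p h] by simp
  moreover have "has_explicit_inverse f" by (rule H_explicit_inverse[OF p h assms(3)])
  moreover have "\<exists>c. \<forall>x. (h ^^ CARD('n)) x = c" using H_funpow_constant[OF p h] by blast
  ultimately show ?thesis
    using in_H_scaleR[OF h] in_H_translate[OF p h] in_H_conjugate[OF p h]
      H_jacobian_nilpotent[OF p h]
    by (simp add: H_class_def has_explicit_inverse_def)
qed

end
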